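(* Let $\pi\ge 1$ be an integer, let $\Delta>0$, let $s(1),\dots,s(\pi)>0$ be packet sizes and let $d(1)>d(2)>\dots>d(\pi)\ge 0$ be packet delays. For $r\in\left[0,\frac1\Delta\sum_{j=1}^{\pi}s(j)\right]$ put $n(r)=\max\left\{k\in\{0,1,\dots,\pi\}:\ \sum_{j=1}^k s(j)\le r\Delta\right\}$ and $$f(r)=\sum_{j=1}^{n(r)}s(j)d(j)+\left(r\Delta-\sum_{j=1}^{n(r)}s(j)\right)d(n(r)+1),$$ where, when $n(r)=\pi$ (so that the bracket is $0$), the second term is read as $0$. Then $f$ is a continuous concave function of $r$ on $\left[0,\frac1\Delta\sum_{j=1}^{\pi}s(j)\right]$.
   Context: The function $f$ is the delay-based reward of a user with $\pi$ queued packets, listed from oldest to newest, with sizes $s(j)$ and delays $d(j)$, when the user is served at rate $r$ during a subframe of length $\Delta$; $n(r)$ is the number of packets served fully. Empty sums are $0$. *)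

theory Defs
  imports "HOL-Analysis.Analysis"
begin

text \<open>
  The number of queued packets is called \<open>N\<close>, since \<open>pi\<close> is the library's constant.
  Packets are indexed from \<open>1\<close> (oldest) to \<open>N\<close> (newest); \<open>s\<close> and \<open>d\<close> are only ever
  evaluated at these indices.
\<close>

definition max_rate :: "nat \<Rightarrow> real \<Rightarrow> (nat \<Rightarrow> real) \<Rightarrow> real" where
  "max_rate N \<Delta> s = 1 / \<Delta> * (\<Sum>j=1..N. s j)"

definition packets_served :: "nat \<Rightarrow> real \<Rightarrow> (nat \<Rightarrow> real) \<Rightarrow> real \<Rightarrow> nat" where
  "packets_served N \<Delta> s r = Max {k \<in> {0..N}. (\<Sum>j=1..k. s j) \<le> r * \<Delta>}"

definition delay_reward ::
  "nat \<Rightarrow> real \<Rightarrow> (nat \<Rightarrow> real) \<Rightarrow> (nat \<Rightarrow> real) \<Rightarrow> real \<Rightarrow> real" where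
  "delay_reward N \<Delta> s d r =
    (let n = packets_served N \<Delta> s r in
      (\<Sum>j=1..n. s j * d j) +
      (if n = N then 0 else (r * \<Delta> - (\<Sum>j=1..n. s j)) * d (n + 1)))"

end

theory Submission
  imports Defs
begin

text \<open>
  Write \<open>T j = s 1 + \<dots> + s j\<close> and put \<open>d (N + 1) = 0\<close>. Summation by parts gives
  \<open>f r = (\<Sum>j=1..N. (d j - d (j + 1)) * min (r * \<Delta>) (T j))\<close>, a combination with nonnegative
  coefficients of minima of affine functions of \<open>r\<close>.
\<close>

text \<open>Abel summation. The boundary term stays because the sum will be cut at the number of
  served packets, where \<open>e (Suc n)\<close> need not vanish.\<close>

lemma sum_by_parts_partial_sums:
  fixes s e :: "nat \<Rightarrow> 'a::comm_ring"
  shows "(\<Sum>j=1..n. (e j - e (Suc j)) * (\<Sum>i=1..j. s i))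
       = (\<Sum>j=1..n. s j * e j) - (\<Sum>j=1..n. s j) * e (Suc n)"
  by (induction n) (simp_all add: algebra_simps)

text \<open>A convex combination of minima lies below the same combination of values of
  \<open>f\<close> and of values of \<open>g\<close>, hence below both functions at the combined
  point.\<close>

lemma concave_on_min:
  assumes "concave_on S f" "concave_on S g"
  shows "concave_on S (\<lambda>x. min (f x) (g x))"
  unfolding concave_on_iff
proof (intro conjI ballI allI impI)
  show "convex S"
    using assms(1) by (rule concave_on_imp_convex)
next
  fix x y and u v :: real
  assume *: "x \<in> S" "y \<in> S" "0 \<le> u" "0 \<le> v" "u + v = 1"
  let ?m = "\<lambda>x. min (f x) (g x)"
  have "u * ?m x + v * ?m y \<le> u * f x + v * f y" "u * ?m x + v * ?m y \<le> u * g x + v * g y"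
    using * by (auto intro!: add_mono mult_left_mono)
  moreover have "u * f x + v * f y \<le> f (u *\<^sub>R x + v *\<^sub>R y)"
    "u * g x + v * g y \<le> g (u *\<^sub>R x + v *\<^sub>R y)"
    using assms * by (auto simp: concave_on_iff)
  ultimately show "u * ?m x + v * ?m y \<le> ?m (u *\<^sub>R x + v *\<^sub>R y)"
    by simp
qed

lemma concave_on_sum_functions:
  assumes "convex S" "\<And>i. i \<in> I \<Longrightarrow> concave_on S (f i)"
  shows "concave_on S (\<lambda>x. \<Sum>i\<in>I. f i x)"
  using assms(2)
  by (induction I rule: infinite_finite_induct)
     (auto simp: concave_on_const assms(1) intro!: concave_on_add)

text \<open>Nonnegativity of \<open>r * \<Delta>\<close> puts \<open>0\<close> into the set, so
  \<open>Max\<close> is attained; the strict bound is maximality tested against the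
  successor.\<close>

lemma packets_served:
  assumes "0 \<le> r * \<Delta>"
  shows packets_served_le: "packets_served N \<Delta> s r \<le> N"
    and sum_packets_served_le: "(\<Sum>j=1..packets_served N \<Delta> s r. s j) \<le> r * \<Delta>"
    and less_sum_Suc_packets_served:
      "packets_served N \<Delta> s r < N \<Longrightarrow> r * \<Delta> < (\<Sum>j=1..Suc (packets_served N \<Delta> s r). s j)"
proof -
  let ?A = "{k \<in> {0..N}. (\<Sum>j=1..k. s j) \<le> r * \<Delta>}"
  let ?n = "packets_served N \<Delta> s r"
  have "0 \<in> ?A"
    using assms by simp
  then have "?n \<in> ?A"
    unfolding packets_served_def by (intro Max_in) auto
  then show "?n \<le> N" "(\<Sum>j=1..?n. s j) \<le> r * \<Delta>"
    by auto
  have "k \<le> ?n" if "k \<in> ?A" for k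
    unfolding packets_served_def using that by (intro Max_ge) auto
  from this[of "Suc ?n"] show "r * \<Delta> < (\<Sum>j=1..Suc ?n. s j)" if "?n < N"
    using that by force
qed

text \<open>Partial sums increase, so the minimum is the partial sum up to the number
  \<open>n\<close> of served packets and \<open>r * \<Delta>\<close> beyond it. Abel summation
  handles the first range and telescoping the second. The sequence \<open>e\<close> replaces
  \<open>d\<close> because \<open>d (Suc N)\<close> is arbitrary.\<close>

lemma delay_reward_eq_sum_min:
  fixes s d :: "nat \<Rightarrow> real"
  assumes s: "\<And>j. j \<in> {1..N} \<Longrightarrow> s j \<ge> 0"
    and r: "0 \<le> r * \<Delta>" "r * \<Delta> \<le> (\<Sum>j=1..N. s j)"
    and e: "\<And>j. j \<in> {1..N} \<Longrightarrow> e j = d j" "e (Suc N) = 0"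
  shows "delay_reward N \<Delta> s d r
       = (\<Sum>j=1..N. (e j - e (Suc j)) * min (r * \<Delta>) (\<Sum>i=1..j. s i))"
proof -
  define n where "n = packets_served N \<Delta> s r"
  define T where "T j = (\<Sum>i=1..j. s i)" for j
  have n: "n \<le> N" "T n \<le> r * \<Delta>" "n < N \<Longrightarrow> r * \<Delta> < T (Suc n)"
    using packets_served[OF r(1)] by (simp_all add: n_def T_def)
  have T_mono: "T i \<le> T j" if "i \<le> j" "j \<le> N" for i j
    unfolding T_def using that s by (intro sum_mono2) auto
  have "(\<Sum>j=1..N. (e j - e (Suc j)) * min (r * \<Delta>) (T j))
      = (\<Sum>j=1..n. (e j - e (Suc j)) * min (r * \<Delta>) (T j))
      + (\<Sum>j=Suc n..N. (e j - e (Suc j)) * min (r * \<Delta>) (T j))"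
    using n(1) sum.ub_add_nat[of 1 n _ "N - n"] by simp
  also have "(\<Sum>j=1..n. (e j - e (Suc j)) * min (r * \<Delta>) (T j))
      = (\<Sum>j=1..n. (e j - e (Suc j)) * T j)"
  proof (intro sum.cong refl)
    fix j assume "j \<in> {1..n}"
    then have "T j \<le> r * \<Delta>"
      using T_mono[of j n] n by simp
    then show "(e j - e (Suc j)) * min (r * \<Delta>) (T j) = (e j - e (Suc j)) * T j"
      by (simp add: min_absorb2)
  qed
  also have "\<dots> = (\<Sum>j=1..n. s j * e j) - T n * e (Suc n)"
    unfolding T_def by (rule sum_by_parts_partial_sums)
  \<comment> \<open>For \<open>n = N\<close> this range is empty, so the strict bound at
    \<open>Suc n\<close> is available whenever it is needed.\<close>
  also have "(\<Sum>j=Suc n..N. (e j - e (Suc j)) * min (r * \<Delta>) (T j))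
      = (\<Sum>j=Suc n..N. (e j - e (Suc j)) * (r * \<Delta>))"
  proof (intro sum.cong refl)
    fix j assume "j \<in> {Suc n..N}"
    then have "r * \<Delta> \<le> T j"
      using T_mono[of "Suc n" j] n(3) by simp
    then show "(e j - e (Suc j)) * min (r * \<Delta>) (T j) = (e j - e (Suc j)) * (r * \<Delta>)"
      by (simp add: min_absorb1)
  qed
  also have "\<dots> = r * \<Delta> * e (Suc n)"
  proof -
    have "(\<Sum>j=Suc n..N. e j - e (Suc j)) = e (Suc n) - e (Suc N)"
      using n(1) sum_Suc_diff[of "Suc n" N "\<lambda>j. - e j"] by simp
    then show ?thesis
      using e(2) by (simp flip: sum_distrib_right)
  qed
  also have "(\<Sum>j=1..n. s j * e j) = (\<Sum>j=1..n. s j * d j)"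
    using e(1) n(1) by (intro sum.cong) auto
  \<comment> \<open>What remains is \<open>(r * \<Delta> - T n) * e (Suc n)\<close>: for
    \<open>n < N\<close> the factor \<open>e (Suc n)\<close> is \<open>d (n + 1)\<close>, and for
    \<open>n = N\<close> it is \<open>0\<close>, matching the case split in the reward.\<close>
  finally show ?thesis
    using n(1) e(1)[of "Suc n"] e(2)
    unfolding delay_reward_def Let_def n_def[symmetric] T_def
    by (auto simp: algebra_simps)
qed

theorem mainTheorem1:
  fixes N :: nat and \<Delta> :: real and s d :: "nat \<Rightarrow> real"
  assumes "N \<ge> 1"
    and "\<Delta> > 0"
    and "\<And>j. j \<in> {1..N} \<Longrightarrow> s j > 0"
    and "\<And>i j. 1 \<le> i \<Longrightarrow> i < j \<Longrightarrow> j \<le> N \<Longrightarrow> d i > d j"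
    and "d N \<ge> 0"
  shows "continuous_on {0..max_rate N \<Delta> s} (delay_reward N \<Delta> s d)
       \<and> concave_on {0..max_rate N \<Delta> s} (delay_reward N \<Delta> s d)"
proof -
  let ?S = "{0..max_rate N \<Delta> s}"
  define e where "e j = (if j \<le> N then d j else 0)" for j
  define g where "g r = (\<Sum>j=1..N. (e j - e (Suc j)) * min (r * \<Delta>) (\<Sum>i=1..j. s i))" for r
  have eq: "delay_reward N \<Delta> s d r = g r" if "r \<in> ?S" for r
    unfolding g_def
  proof (rule delay_reward_eq_sum_min)
    show "0 \<le> r * \<Delta>" "r * \<Delta> \<le> (\<Sum>j=1..N. s j)"
      using that \<open>\<Delta> > 0\<close> by (auto simp: max_rate_def field_simps)
  qed (use assms(3) in \<open>auto simp: e_def less_imp_le\<close>)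
  \<comment> \<open>Decreasing delays give the sign for \<open>j < N\<close>; the last coefficient
    is \<open>d N\<close> itself.\<close>
  have e_diff: "0 \<le> e j - e (Suc j)" if "j \<in> {1..N}" for j
    using that assms(4)[of j "Suc j"] assms(5) by (cases "j = N") (auto simp: e_def)
  have "continuous_on ?S g"
    unfolding g_def by (intro continuous_intros)
  moreover have "concave_on ?S g"
    unfolding g_def
  proof (intro concave_on_sum_functions concave_on_cmul concave_on_min)
    show "concave_on ?S (\<lambda>r. r * \<Delta>)"
      using \<open>\<Delta> > 0\<close> concave_on_cmul[of \<Delta> ?S "\<lambda>r. r"] by (simp add: concave_on_ident mult.commute)
  qed (use e_diff in \<open>auto simp: concave_on_const\<close>)
  \<comment> \<open>Convexity of the interval lets \<open>eq\<close> be applied at the convex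
    combination as well as at the two endpoints.\<close>
  then have "concave_on ?S (delay_reward N \<Delta> s d)"
    using eq convexD[OF convex_real_interval(5)[of 0 "max_rate N \<Delta> s"]]
    unfolding concave_on_iff by (metis (no_types, lifting))
  ultimately show ?thesis
    using eq continuous_on_cong by blast
qed

end
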